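(* Let $\{s(n)\}_{n\ge 0}$ be Stern's sequence and $\{t(n)\}_{n\ge0}$ the twisted Stern sequence, with generating series $S(z)=\sum_{n\ge0}s(n)z^n$. Define the formal power series $U(z)=\sum_{n\ge0}u(n)z^n$ by $$U(z):=\frac{\sum_{n\geq 0}t(3+n)z^n}{S(z)}.$$ Then $\{u(n)\}_{n\ge0}$ is an integral sequence, and for all $e\geq 0$ we have $$\sum_{n\geq 0} t(3\cdot 2^e+n)z^n=(-1)^eS(z)\sum_{n\geq 0}u(n)z^{n\cdot 2^e}.$$
   Context: Stern's sequence is defined by $s(0)=0$, $s(1)=1$, and for $n\ge1$, $s(2n)=s(n)$, $s(2n+1)=s(n)+s(n+1)$. The twisted Stern sequence is defined by $t(0)=0$, $t(1)=1$, and for $n\ge1$, $t(2n)=-t(n)$, $t(2n+1)=-t(n)-t(n+1)$. All series are formal power series in $z$. *)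

theory Defs
  imports "HOL-Computational_Algebra.Formal_Power_Series"
begin

function stern :: "nat \<Rightarrow> int" where
  "stern n =
     (if n = 0 then 0
      else if n = 1 then 1
      else if even n then stern (n div 2)
      else stern (n div 2) + stern (n div 2 + 1))"
  by auto
termination
  by (relation "measure id") (auto elim!: oddE)

function twisted_stern :: "nat \<Rightarrow> int" where
  "twisted_stern n =
     (if n = 0 then 0
      else if n = 1 then 1
      else if even n then - twisted_stern (n div 2)
      else - twisted_stern (n div 2) - twisted_stern (n div 2 + 1))"
  by auto
termination
  by (relation "measure id") (auto elim!: oddE)

declare stern.simps [simp del] twisted_stern.simps [simp del]

lemma stern_recurrence:
  "stern 0 = 0" "stern 1 = 1"
  "n \<ge> 1 \<Longrightarrow> stern (2 * n) = stern n"
  "n \<ge> 1 \<Longrightarrow> stern (2 * n + 1) = stern n + stern (n + 1)"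
  by (simp_all add: stern.simps [of 0] stern.simps [of "Suc 0"]
      stern.simps [of "2 * n"] stern.simps [of "Suc (2 * n)"])

lemma twisted_stern_recurrence:
  "twisted_stern 0 = 0" "twisted_stern 1 = 1"
  "n \<ge> 1 \<Longrightarrow> twisted_stern (2 * n) = - twisted_stern n"
  "n \<ge> 1 \<Longrightarrow> twisted_stern (2 * n + 1) = - twisted_stern n - twisted_stern (n + 1)"
  by (simp_all add: twisted_stern.simps [of 0] twisted_stern.simps [of "Suc 0"]
      twisted_stern.simps [of "2 * n"] twisted_stern.simps [of "Suc (2 * n)"])

(* Rational coefficients make the integrality of a quotient of such series
   a property to be proved. *)
definition stern_series :: "rat fps" where
  "stern_series = Abs_fps (\<lambda>n. of_int (stern n))"

definition twisted_stern_series_from :: "nat \<Rightarrow> rat fps" where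
  "twisted_stern_series_from m = Abs_fps (\<lambda>n. of_int (twisted_stern (m + n)))"

(* Division on fps over a field discards negative powers of z. Nothing is lost
   here: stern_series has subdegree 1 and twisted_stern 3 = 0. *)
definition U_series :: "rat fps" where
  "U_series = twisted_stern_series_from 3 / stern_series"

end

theory Submission
  imports Defs "HOL-Computational_Algebra.Formal_Laurent_Series"
begin

unbundle fps_syntax

text \<open>
  Since \<open>t(3 * 2^e) = 0\<close>, the recurrences give, for \<open>T_e = \<Sum>n. t(3 * 2^e + n) z^n\<close>, the equations
  \<open>z T_{e+1}(z) = - (1 + z + z^2) T_e(z^2)\<close> and \<open>z S(z) = (1 + z + z^2) S(z^2)\<close>, so that the
  quotient \<open>T_e / S\<close> satisfies \<open>(T_{e+1} / S)(z) = - (T_e / S)(z^2)\<close>.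
  Integrality holds because \<open>S = z + \<dots>\<close> is \<open>z\<close> times a unit among the integral series.
\<close>

text \<open>On the right, \<open>f oo fps_X ^ 2\<close> has only even powers. The coefficient at
  2k+1 thus comes from the factor z alone and is \<open>f $ k\<close>; the one at 2k+2 comes from 1
  and z^2 and is \<open>f $ (k + 1) + f $ k\<close>. Two series are allowed so that one lemma serves
  both f = g = S and f = T_m, g = -T_{2m}.\<close>

lemma fps_X_mult_eq_dissection:
  fixes f g :: "'a::comm_ring_1 fps"
  assumes "f $ 0 = 0"
    and even: "\<And>n. g $ (2 * n) = f $ n"
    and odd: "\<And>n. g $ (2 * n + 1) = f $ n + f $ (n + 1)"
  shows "fps_X * g = (1 + fps_X + fps_X ^ 2) * (f oo fps_X ^ 2)"
proof (rule fps_ext)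
  fix n
  have rhs: "((1 + fps_X + fps_X ^ 2) * (f oo fps_X ^ 2)) $ n =
    (if even n then f $ (n div 2) else 0) +
    (if n = 0 then 0 else if odd n then f $ ((n - 1) div 2) else 0) +
    (if n < 2 then 0 else if even n then f $ ((n - 2) div 2) else 0)"
    by (auto simp: distrib_right fps_X_power_mult_nth fps_nth_compose_X_power)
  show "(fps_X * g) $ n = ((1 + fps_X + fps_X ^ 2) * (f oo fps_X ^ 2)) $ n"
  proof (cases n)
    case 0
    then show ?thesis using assms(1) by (simp add: rhs)
  next
    case (Suc m)
    consider k where "m = 2 * k" | k where "m = 2 * k + 1"
      by (meson evenE oddE)
    then show ?thesis
    proof cases
      case 1
      then show ?thesis unfolding rhs using even[of k] Suc by simp
    next
      case 2
      then show ?thesis unfolding rhs using odd[of k] Suc by simp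
    qed
  qed
qed

lemma stern_series_functional_equation:
  "fps_X * stern_series = (1 + fps_X + fps_X ^ 2) * (stern_series oo fps_X ^ 2)"
proof (rule fps_X_mult_eq_dissection)
  fix n
  show "stern_series $ (2 * n) = stern_series $ n"
    using stern_recurrence(1) stern_recurrence(3)[of n]
    \<comment> \<open>The recurrences start at 1, but for Stern's sequence both relations also hold
      at index 0.\<close>
    by (cases "n = 0") (simp_all add: stern_series_def)
  show "stern_series $ (2 * n + 1) = stern_series $ n + stern_series $ (n + 1)"
    using stern_recurrence(1,2) stern_recurrence(4)[of n]
    by (cases "n = 0") (simp_all add: stern_series_def)
qed (simp add: stern_series_def stern_recurrence)

text \<open>Negating the left series turns the twisted recurrences into the signs of the dissection.
  The bound on m avoids index 0, where t(1) = -t(0) - t(1) would fail; t(m) = 0 gives the zero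
  constant term.\<close>

lemma twisted_stern_series_functional_equation:
  assumes "m \<ge> 1" and "twisted_stern m = 0"
  shows "fps_X * twisted_stern_series_from (2 * m) =
    - ((1 + fps_X + fps_X ^ 2) * (twisted_stern_series_from m oo fps_X ^ 2))"
proof -
  have "fps_X * (- twisted_stern_series_from (2 * m)) =
    (1 + fps_X + fps_X ^ 2) * (twisted_stern_series_from m oo fps_X ^ 2)"
  proof (rule fps_X_mult_eq_dissection)
    fix n
    show "(- twisted_stern_series_from (2 * m)) $ (2 * n) = twisted_stern_series_from m $ n"
      using twisted_stern_recurrence(3)[of "m + n"] assms
      by (simp add: twisted_stern_series_from_def)
    show "(- twisted_stern_series_from (2 * m)) $ (2 * n + 1) =
        twisted_stern_series_from m $ n + twisted_stern_series_from m $ (n + 1)"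
      using twisted_stern_recurrence(4)[of "m + n"] assms
      by (simp add: twisted_stern_series_from_def)
  qed (simp add: twisted_stern_series_from_def assms)
  then show ?thesis by (metis minus_minus mult_minus_right)
qed

lemma twisted_stern_3: "twisted_stern 3 = 0"
  using twisted_stern_recurrence(3)[of 1] twisted_stern_recurrence(4)[of 1]
  by (simp add: twisted_stern_recurrence(2)[simplified] numeral_2_eq_2 numeral_3_eq_3)

text \<open>This makes the functional equation available at every m = 3 * 2^e.\<close>

lemma twisted_stern_three_mult_power: "twisted_stern (3 * 2 ^ e) = 0"
proof (induction e)
  case (Suc e)
  then show ?case
    using twisted_stern_recurrence(3)[of "3 * 2 ^ e"] by (simp add: mult.left_commute)
qed (simp add: twisted_stern_3)

lemma stern_series_nth_0_1: "stern_series $ 0 = 0" "stern_series $ 1 = 1"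
  using stern_recurrence(1,2) by (simp_all add: stern_series_def)

lemma stern_series_mult_U_series: "stern_series * U_series = twisted_stern_series_from 3"
proof -
  have "subdegree stern_series = 1"
    by (rule subdegreeI) (use stern_series_nth_0_1 in auto)
  \<comment> \<open>The zero series has subdegree 0 by convention, so it is kept apart.\<close>
  moreover have "twisted_stern_series_from 3 = 0 \<or> subdegree (twisted_stern_series_from 3) \<ge> 1"
    using twisted_stern_3
    by (auto intro!: subdegree_geI simp: twisted_stern_series_from_def)
  moreover have "stern_series \<noteq> 0"
    using stern_series_nth_0_1 by auto
  ultimately have "stern_series dvd twisted_stern_series_from 3"
    by (cases "twisted_stern_series_from 3 = 0") (simp_all add: fps_dvd_iff)
  then show ?thesis
    by (simp add: U_series_def)
qed

lemma U_series_nth_Ints: "U_series $ n \<in> \<int>"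
proof (induction n rule: less_induct)
  case (less n)
  \<comment> \<open>At index n + 1, s(0) = 0 removes u(n+1) and s(1) = 1 leaves u(n) with
    coefficient 1, so u(n) is an integer combination of earlier terms plus an integer.\<close>
  have "twisted_stern_series_from 3 $ Suc n =
      (\<Sum>i\<le>Suc n. U_series $ i * stern_series $ (Suc n - i))"
    by (simp flip: stern_series_mult_U_series add: mult.commute[of stern_series]
        fps_mult_nth atLeast0AtMost)
  also have "\<dots> = (\<Sum>i<n. U_series $ i * stern_series $ (Suc n - i)) + U_series $ n"
    using stern_series_nth_0_1 by (simp add: lessThan_Suc_atMost[symmetric])
  finally have "U_series $ n = twisted_stern_series_from 3 $ Suc n -
      (\<Sum>i<n. U_series $ i * stern_series $ (Suc n - i))"
    by simp
  also have "\<dots> \<in> \<int>"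
    using less by (auto intro!: Ints_diff Ints_mult Ints_sum
        simp: twisted_stern_series_from_def stern_series_def)
  finally show ?case .
qed

lemma twisted_stern_series_three_mult_power:
  "twisted_stern_series_from (3 * 2 ^ e) =
    (-1) ^ e * stern_series * (U_series oo fps_X ^ (2 ^ e))"
proof (induction e)
  case 0
  then show ?case by (simp add: stern_series_mult_U_series)
next
  case (Suc e)
  let ?P = "1 + fps_X + fps_X ^ 2 :: rat fps" and ?X2 = "fps_X ^ 2 :: rat fps"
  have U: "(U_series oo fps_X ^ (2 ^ e)) oo ?X2 = U_series oo fps_X ^ (2 ^ Suc e)"
    by (simp add: fps_compose_assoc[symmetric] fps_compose_power[symmetric] flip: power_mult)
  have sign: "((-1) ^ e :: rat fps) oo ?X2 = (-1) ^ e"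
    by (simp add: fps_compose_power[symmetric] fps_compose_uminus)
  have "fps_X * twisted_stern_series_from (3 * 2 ^ Suc e) =
      - (?P * (twisted_stern_series_from (3 * 2 ^ e) oo ?X2))"
    using twisted_stern_series_functional_equation[of "3 * 2 ^ e"]
    by (simp add: twisted_stern_three_mult_power mult.left_commute)
  \<comment> \<open>Substituting z^2 into the induction hypothesis is multiplicative; the factors
    are grouped so that the functional equation of S, read backwards, yields z S, and z then
    cancels.\<close>
  also have "\<dots> = (-1) ^ Suc e * (?P * (stern_series oo ?X2)) * (U_series oo fps_X ^ (2 ^ Suc e))"
    by (simp add: Suc.IH fps_compose_mult_distrib sign U mult_ac del: power_Suc)
       (simp add: mult_ac)
  also have "\<dots> = fps_X * ((-1) ^ Suc e * stern_series * (U_series oo fps_X ^ (2 ^ Suc e)))"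
    by (simp only: flip: stern_series_functional_equation) (simp only: mult_ac)
  finally show ?case by (simp only: mult_cancel_left fps_X_neq_zero simp_thms)
qed

theorem theorem1p1:
  shows "(\<forall>n. fps_nth U_series n \<in> \<int>) \<and>
    (\<forall>e. twisted_stern_series_from (3 * 2 ^ e) =
       (-1) ^ e * stern_series * (U_series oo fps_X ^ (2 ^ e)))"
  using U_series_nth_Ints twisted_stern_series_three_mult_power by blast

end
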